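(* Let $G$ be a group, let $A$ and $B$ be proper isomorphic subgroups of $G$, and let $\phi: A \to B$ be an isomorphism. Then the HNN extension $$G_{\ast} = \langle G, t \mid t^{-1} a t = \phi(a),\ a \in A \rangle$$ of $G$ with associated subgroups $A$ and $B$ has infinite palindromic width with respect to the generating set $G \cup \{t, t^{-1}\}$. That is, $pw(G_\ast, G \cup \{t,t^{-1}\}) = \infty$.
   Context: Reduced words: a sequence $g_0, t^{\epsilon_1}, g_1, \ldots, t^{\epsilon_n}, g_n$ ($n \ge 0$, $g_i \in G$, $\epsilon_i \in \{1,-1\}$) is reduced if it contains no subsequence of consecutive terms of the form $t^{-1}, g_i, t$ with $g_i \in A$ or $t, g_i, t^{-1}$ with $g_i \in B$. The corresponding expression $g_0 t^{\epsilon_1} g_1 \cdots t^{\epsilon_n} g_n$ is called a reduced word. Every element of $G_\ast$ is represented by some reduced word. A palindrome in $G_\ast$ with respect to the generating set $G\cup\{t,t^{-1}\}$ is a reduced word $g_0 t^{\epsilon_1} g_1 \cdots t^{\epsilon_n} g_n$ which reads the same forward and backward, i.e. $g_i = g_{n-i}$ for $0 \le i \le n$ and $\epsilon_i = \epsilon_{n+1-i}$ for $1 \le i \le n$. An element of $G_\ast$ represented by such a word is also called a palindrome. The palindromic length $l_{\mathcal P}(g)$ of $g \in G_\ast$ is the minimum number $k$ such that $g$ is a product of $k$ palindromes. The palindromic width is $pw(G_\ast, G\cup\{t,t^{-1}\}) = \sup_{g \in G_\ast} l_{\mathcal P}(g)$. *)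

theory Defs
  imports "HOL-Algebra.Group" "HOL-Library.Extended_Nat"
begin

text \<open>
  \<open>Base g\<close> is the letter \<open>g \<in> G\<close>, and \<open>Stable e\<close> is the letter \<open>t\<^sup>e\<close> with \<open>e\<close> either \<open>1\<close> or \<open>-1\<close>.
\<close>

datatype 'a hnn_letter = Base 'a | Stable int

definition hnn_words :: "('a, 'b) monoid_scheme \<Rightarrow> 'a hnn_letter list set" where
  "hnn_words G = lists (Base ` carrier G \<union> Stable ` {1, -1})"

text \<open>
  The congruence on words presenting \<open>\<langle>G, t | t\<^sup>-\<^sup>1 a t = \<phi> a, a \<in> A\<rangle>\<close>: \<open>mult\<close> and \<open>one\<close> impose the
  multiplication table of \<open>G\<close>, \<open>cancel\<close> makes \<open>t\<close> and \<open>t\<^sup>-\<^sup>1\<close> mutually inverse, and \<open>conj\<close> gives the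
  defining relations. Every letter thereby becomes invertible, so the quotient monoid is the
  presented group.
\<close>

inductive hnn_eq ::
  "('a, 'b) monoid_scheme \<Rightarrow> 'a set \<Rightarrow> ('a \<Rightarrow> 'a) \<Rightarrow> 'a hnn_letter list \<Rightarrow> 'a hnn_letter list \<Rightarrow> bool"
  for G :: "('a, 'b) monoid_scheme" and A :: "'a set" and \<phi> :: "'a \<Rightarrow> 'a" where
  refl: "w \<in> hnn_words G \<Longrightarrow> hnn_eq G A \<phi> w w"
| sym: "hnn_eq G A \<phi> v w \<Longrightarrow> hnn_eq G A \<phi> w v"
| trans: "hnn_eq G A \<phi> u v \<Longrightarrow> hnn_eq G A \<phi> v w \<Longrightarrow> hnn_eq G A \<phi> u w"
| append: "hnn_eq G A \<phi> u u' \<Longrightarrow> hnn_eq G A \<phi> v v' \<Longrightarrow> hnn_eq G A \<phi> (u @ v) (u' @ v')"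
| mult: "g \<in> carrier G \<Longrightarrow> h \<in> carrier G \<Longrightarrow> hnn_eq G A \<phi> [Base g, Base h] [Base (g \<otimes>\<^bsub>G\<^esub> h)]"
| one: "hnn_eq G A \<phi> [Base \<one>\<^bsub>G\<^esub>] []"
| cancel: "e \<in> {1, -1} \<Longrightarrow> hnn_eq G A \<phi> [Stable e, Stable (- e)] []"
| conj: "a \<in> A \<Longrightarrow> hnn_eq G A \<phi> [Stable (-1), Base a, Stable 1] [Base (\<phi> a)]"

definition hnn_class ::
  "('a, 'b) monoid_scheme \<Rightarrow> 'a set \<Rightarrow> ('a \<Rightarrow> 'a) \<Rightarrow> 'a hnn_letter list \<Rightarrow> 'a hnn_letter list set" where
  "hnn_class G A \<phi> w = {v. hnn_eq G A \<phi> w v}"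

definition hnn_extension ::
  "('a, 'b) monoid_scheme \<Rightarrow> 'a set \<Rightarrow> ('a \<Rightarrow> 'a) \<Rightarrow> 'a hnn_letter list set monoid" where
  "hnn_extension G A \<phi> =
    \<lparr>carrier = hnn_class G A \<phi> ` hnn_words G,
     mult = (\<lambda>X Y. \<Union>x\<in>X. \<Union>y\<in>Y. hnn_class G A \<phi> (x @ y)),
     one = hnn_class G A \<phi> []\<rparr>"

text \<open>
  The sequence \<open>g\<^sub>0, t\<^bsup>\<epsilon>\<^sub>1\<^esup>, g\<^sub>1, \<dots>, t\<^bsup>\<epsilon>\<^sub>n\<^esup>, g\<^sub>n\<close> is given by the lists \<open>gs = [g\<^sub>0, \<dots>, g\<^sub>n]\<close> and
  \<open>es = [\<epsilon>\<^sub>1, \<dots>, \<epsilon>\<^sub>n]\<close>. Lists are indexed from \<open>0\<close>, so \<open>\<epsilon>\<^sub>i = es ! (i - 1)\<close>, and \<open>gs ! Suc i\<close> stands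
  between \<open>es ! i\<close> and \<open>es ! Suc i\<close>.
\<close>

definition hnn_word :: "'a list \<Rightarrow> int list \<Rightarrow> 'a hnn_letter list" where
  "hnn_word gs es = Base (hd gs) # concat (map2 (\<lambda>e g. [Stable e, Base g]) es (tl gs))"

definition hnn_reduced ::
  "('a, 'b) monoid_scheme \<Rightarrow> 'a set \<Rightarrow> 'a set \<Rightarrow> 'a list \<Rightarrow> int list \<Rightarrow> bool" where
  "hnn_reduced G A B gs es \<longleftrightarrow>
    length gs = Suc (length es) \<and> set gs \<subseteq> carrier G \<and> set es \<subseteq> {1, -1} \<and>
    (\<forall>i. Suc i < length es \<longrightarrow>
      \<not> (es ! i = -1 \<and> gs ! Suc i \<in> A \<and> es ! Suc i = 1) \<and>
      \<not> (es ! i = 1 \<and> gs ! Suc i \<in> B \<and> es ! Suc i = -1))"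

definition hnn_palindromes ::
  "('a, 'b) monoid_scheme \<Rightarrow> 'a set \<Rightarrow> 'a set \<Rightarrow> ('a \<Rightarrow> 'a) \<Rightarrow> 'a hnn_letter list set set" where
  "hnn_palindromes G A B \<phi> =
    {hnn_class G A \<phi> (hnn_word gs es) | gs es.
      hnn_reduced G A B gs es \<and> rev gs = gs \<and> rev es = es}"

definition hnn_palindromic_length ::
  "('a, 'b) monoid_scheme \<Rightarrow> 'a set \<Rightarrow> 'a set \<Rightarrow> ('a \<Rightarrow> 'a) \<Rightarrow> 'a hnn_letter list set \<Rightarrow> nat" where
  "hnn_palindromic_length G A B \<phi> x =
    (LEAST k. \<exists>ps. length ps = k \<and> set ps \<subseteq> hnn_palindromes G A B \<phi> \<and>
      x = foldr (\<lambda>p q. p \<otimes>\<^bsub>hnn_extension G A \<phi>\<^esub> q) ps \<one>\<^bsub>hnn_extension G A \<phi>\<^esub>)"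

definition hnn_palindromic_width ::
  "('a, 'b) monoid_scheme \<Rightarrow> 'a set \<Rightarrow> 'a set \<Rightarrow> ('a \<Rightarrow> 'a) \<Rightarrow> enat" where
  "hnn_palindromic_width G A B \<phi> =
    (SUP x\<in>carrier (hnn_extension G A \<phi>). enat (hnn_palindromic_length G A B \<phi> x))"

context
  fixes G :: "('a, 'b) monoid_scheme" (structure) and A B :: "'a set" and \<phi> :: "'a \<Rightarrow> 'a"
  assumes G: "group G" and A: "subgroup A G"
    and \<phi>: "\<phi> ` A \<subseteq> carrier G"
begin

interpretation group G by (rule G)

lemma hnn_words_append: "u @ v \<in> hnn_words G \<longleftrightarrow> u \<in> hnn_words G \<and> v \<in> hnn_words G"
  by (auto simp: hnn_words_def)

lemma hnn_eq_words: "hnn_eq G A \<phi> u v \<Longrightarrow> u \<in> hnn_words G \<and> v \<in> hnn_words G"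
proof (induction rule: hnn_eq.induct)
  case (conj a)
  then have "a \<in> carrier G" "\<phi> a \<in> carrier G" using A \<phi> subgroup.subset by blast+
  then show ?case by (auto simp: hnn_words_def)
qed (auto simp: hnn_words_def)

lemma hnn_class_eq_iff:
  assumes "u \<in> hnn_words G"
  shows "hnn_class G A \<phi> u = hnn_class G A \<phi> v \<longleftrightarrow> hnn_eq G A \<phi> u v"
proof
  assume "hnn_class G A \<phi> u = hnn_class G A \<phi> v"
  then have "hnn_eq G A \<phi> v u"
    using hnn_eq.refl[OF assms, of A \<phi>] unfolding hnn_class_def by blast
  then show "hnn_eq G A \<phi> u v" by (rule hnn_eq.sym)
next
  assume uv: "hnn_eq G A \<phi> u v"
  show "hnn_class G A \<phi> u = hnn_class G A \<phi> v"
    unfolding hnn_class_def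
    using hnn_eq.trans[OF uv] hnn_eq.trans[OF hnn_eq.sym[OF uv]] by blast
qed

lemma hnn_mult_class:
  assumes "u \<in> hnn_words G" "v \<in> hnn_words G"
  shows "hnn_class G A \<phi> u \<otimes>\<^bsub>hnn_extension G A \<phi>\<^esub> hnn_class G A \<phi> v = hnn_class G A \<phi> (u @ v)"
proof -
  have *: "hnn_class G A \<phi> (x @ y) = hnn_class G A \<phi> (u @ v)"
    if "x \<in> hnn_class G A \<phi> u" "y \<in> hnn_class G A \<phi> v" for x y
  proof -
    have "hnn_eq G A \<phi> (u @ v) (x @ y)"
      using that by (simp add: hnn_class_def hnn_eq.append)
    then show ?thesis
      using assms hnn_class_eq_iff[of "u @ v" "x @ y"] by (simp add: hnn_words_append)
  qed
  have uv: "u \<in> hnn_class G A \<phi> u" "v \<in> hnn_class G A \<phi> v"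
    using assms by (simp_all add: hnn_class_def hnn_eq.refl)
  have "(\<Union>x\<in>hnn_class G A \<phi> u. \<Union>y\<in>hnn_class G A \<phi> v. hnn_class G A \<phi> (x @ y)) =
      (\<Union>x\<in>hnn_class G A \<phi> u. \<Union>y\<in>hnn_class G A \<phi> v. hnn_class G A \<phi> (u @ v))"
    by (intro SUP_cong *) (rule HOL.refl)+
  also have "\<dots> = hnn_class G A \<phi> (u @ v)"
    using uv by blast
  finally show ?thesis by (simp add: hnn_extension_def)
qed

lemma hnn_letter_inverse:
  assumes "x \<in> Base ` carrier G \<union> Stable ` {1, -1}"
  shows "\<exists>y \<in> Base ` carrier G \<union> Stable ` {1, -1}. hnn_eq G A \<phi> [y, x] []"
  using assms
proof (elim UnE imageE)
  fix g assume g: "x = Base g" "g \<in> carrier G"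
  have "hnn_eq G A \<phi> [Base (inv g), Base g] [Base \<one>]"
    using hnn_eq.mult[of "inv g" G g A \<phi>] g by simp
  then have "hnn_eq G A \<phi> [Base (inv g), x] []"
    unfolding g(1) by (rule hnn_eq.trans) (rule hnn_eq.one)
  then show ?thesis using g by blast
next
  fix e :: int assume e: "x = Stable e" "e \<in> {1, -1}"
  have "hnn_eq G A \<phi> [Stable (- e), x] []"
    using hnn_eq.cancel[of "- e" G A \<phi>] e by auto
  then show ?thesis using e by (intro bexI[of _ "Stable (- e)"]) auto
qed

lemma hnn_word_inverse:
  "w \<in> hnn_words G \<Longrightarrow> \<exists>v \<in> hnn_words G. hnn_eq G A \<phi> (v @ w) []"
proof (induction w)
  case Nil
  then show ?case using hnn_eq.refl[of "[]" G A \<phi>] by (intro bexI[of _ "[]"]) auto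
next
  case (Cons x w)
  have x: "x \<in> Base ` carrier G \<union> Stable ` {1, -1}" and w: "w \<in> hnn_words G"
    using Cons.prems by (auto simp: hnn_words_def)
  obtain y where y: "y \<in> Base ` carrier G \<union> Stable ` {1, -1}" "hnn_eq G A \<phi> [y, x] []"
    using hnn_letter_inverse[OF x] by blast
  obtain v where v: "v \<in> hnn_words G" "hnn_eq G A \<phi> (v @ w) []"
    using Cons.IH[OF w] by blast
  have "hnn_eq G A \<phi> (v @ ([y, x] @ w)) (v @ ([] @ w))"
    by (intro hnn_eq.append hnn_eq.refl v w y)
  then have "hnn_eq G A \<phi> ((v @ [y]) @ x # w) []"
    using hnn_eq.trans[OF _ v(2)] by simp
  moreover have "v @ [y] \<in> hnn_words G"
    using v(1) y(1) by (auto simp: hnn_words_def)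
  ultimately show ?case by blast
qed

lemma group_hnn_extension: "group (hnn_extension G A \<phi>)"
proof (rule groupI)
  let ?H = "hnn_extension G A \<phi>"
  have carrier: "carrier ?H = hnn_class G A \<phi> ` hnn_words G"
    and one: "\<one>\<^bsub>?H\<^esub> = hnn_class G A \<phi> []"
    by (simp_all add: hnn_extension_def)
  have Nil: "[] \<in> hnn_words G" by (simp add: hnn_words_def)
  show "\<one>\<^bsub>?H\<^esub> \<in> carrier ?H" using Nil by (simp add: carrier one)
  show "x \<otimes>\<^bsub>?H\<^esub> y \<in> carrier ?H" if "x \<in> carrier ?H" "y \<in> carrier ?H" for x y
    using that by (auto simp: carrier hnn_mult_class hnn_words_append)
  show "x \<otimes>\<^bsub>?H\<^esub> y \<otimes>\<^bsub>?H\<^esub> z = x \<otimes>\<^bsub>?H\<^esub> (y \<otimes>\<^bsub>?H\<^esub> z)"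
    if "x \<in> carrier ?H" "y \<in> carrier ?H" "z \<in> carrier ?H" for x y z
    using that by (auto simp: carrier hnn_mult_class hnn_words_append)
  show "\<one>\<^bsub>?H\<^esub> \<otimes>\<^bsub>?H\<^esub> x = x" if "x \<in> carrier ?H" for x
    using that Nil by (auto simp: carrier one hnn_mult_class)
  show "\<exists>y\<in>carrier ?H. y \<otimes>\<^bsub>?H\<^esub> x = \<one>\<^bsub>?H\<^esub>" if x: "x \<in> carrier ?H" for x
  proof -
    obtain w where w: "w \<in> hnn_words G" "x = hnn_class G A \<phi> w"
      using x by (auto simp: carrier)
    obtain v where v: "v \<in> hnn_words G" "hnn_eq G A \<phi> (v @ w) []"
      using hnn_word_inverse[OF w(1)] by blast
    have "hnn_class G A \<phi> v \<otimes>\<^bsub>?H\<^esub> x = \<one>\<^bsub>?H\<^esub>"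
      using w v by (simp add: one hnn_mult_class hnn_class_eq_iff hnn_words_append)
    then show ?thesis using v(1) by (auto simp: carrier)
  qed
qed

lemma hnn_letter_palindrome:
  assumes "x \<in> Base ` carrier G \<union> Stable ` {1, -1}"
  shows "hnn_class G A \<phi> [x] \<in> hnn_palindromes G A B \<phi>"
  using assms
proof (elim UnE imageE)
  fix g assume g: "x = Base g" "g \<in> carrier G"
  have "[x] = hnn_word [g] []" "hnn_reduced G A B [g] []"
    using g by (auto simp: hnn_word_def hnn_reduced_def)
  then show ?thesis unfolding hnn_palindromes_def
    by (intro CollectI exI[of _ "[g]"] exI[of _ "[]"]) simp
next
  fix e :: int assume e: "x = Stable e" "e \<in> {1, -1}"
  have s: "[x] \<in> hnn_words G" using e by (auto simp: hnn_words_def)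
  have "hnn_eq G A \<phi> ([Base \<one>] @ [x] @ [Base \<one>]) ([] @ [x] @ [])"
    by (intro hnn_eq.append hnn_eq.one hnn_eq.refl s)
  then have "hnn_eq G A \<phi> [x] (hnn_word [\<one>, \<one>] [e])"
    unfolding e(1) by (intro hnn_eq.sym[of G A \<phi> "hnn_word [\<one>, \<one>] [e]"]) (simp add: hnn_word_def)
  then have "hnn_class G A \<phi> [x] = hnn_class G A \<phi> (hnn_word [\<one>, \<one>] [e])"
    using s hnn_class_eq_iff by blast
  moreover have "hnn_reduced G A B [\<one>, \<one>] [e]"
    using e by (auto simp: hnn_reduced_def)
  ultimately show ?thesis unfolding hnn_palindromes_def
    by (intro CollectI exI[of _ "[\<one>, \<one>]"] exI[of _ "[e]"]) simp
qed

text \<open>The minimum in the definition of the palindromic length is taken over a nonempty set.\<close>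

lemma hnn_palindromic_length_exists:
  assumes "x \<in> carrier (hnn_extension G A \<phi>)"
  shows "\<exists>k ps. length ps = k \<and> set ps \<subseteq> hnn_palindromes G A B \<phi> \<and>
    x = foldr (\<lambda>p q. p \<otimes>\<^bsub>hnn_extension G A \<phi>\<^esub> q) ps \<one>\<^bsub>hnn_extension G A \<phi>\<^esub>"
proof -
  let ?H = "hnn_extension G A \<phi>"
  have "hnn_class G A \<phi> w =
      foldr (\<lambda>p q. p \<otimes>\<^bsub>?H\<^esub> q) (map (\<lambda>x. hnn_class G A \<phi> [x]) w) \<one>\<^bsub>?H\<^esub>"
    if "w \<in> hnn_words G" for w
    using that
  proof (induction w)
    case Nil
    then show ?case by (simp add: hnn_extension_def)
  next
    case (Cons x w)
    then have "[x] \<in> hnn_words G" "w \<in> hnn_words G" by (auto simp: hnn_words_def)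
    then show ?case using Cons.IH hnn_mult_class[of "[x]" w] by simp
  qed
  moreover obtain w where w: "w \<in> hnn_words G" "x = hnn_class G A \<phi> w"
    using assms by (auto simp: hnn_extension_def)
  moreover have "set (map (\<lambda>x. hnn_class G A \<phi> [x]) w) \<subseteq> hnn_palindromes G A B \<phi>"
    using w(1) hnn_letter_palindrome by (auto simp: hnn_words_def in_lists_conv_set)
  ultimately show ?thesis by blast
qed

end

end

theory Submission imports Defs begin

text \<open>
  By Britton's lemma the exponent sequence of a reduced word depends only on the element it
  represents; we obtain this from the action of words on normal forms. In a product of two
  elements, a suffix \<open>x\<close> of the first exponent sequence cancels against a prefix \<open>- rev x\<close> of the
  second one. Counting the windows \<open>+--+++\<close> and \<open>-++---\<close> and subtracting the count of the reversed
  windows gives an almost additive function of the exponent sequence that changes sign under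
  reversal and is unchanged under negation. It therefore vanishes on palindromes and is a
  quasimorphism, so it is linearly bounded in the number of palindromic factors. Since \<open>A\<close> and \<open>B\<close>
  are proper, every exponent sequence occurs, and on the powers of a suitable block the function
  is unbounded.
\<close>

section \<open>Counting windows\<close>

text \<open>Negation exchanges the two windows, and neither is the reversal of itself or of the
  other, so the signed count is not identically zero.\<close>

definition asym_window :: "int list \<Rightarrow> bool" where
  "asym_window w \<longleftrightarrow> w = [1,-1,-1,1,1,1] \<or> w = [-1,1,1,-1,-1,-1]"

definition window_sign :: "int list \<Rightarrow> int" where
  "window_sign w = of_bool (asym_window w) - of_bool (asym_window (rev w))"

text \<open>Near the end \<open>take 6\<close> gives fewer than six entries; such pieces have sign
  0, so only full windows count.\<close>

fun window_count :: "int list \<Rightarrow> int" where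
  "window_count [] = 0"
| "window_count (x # xs) = window_sign (take 6 (x # xs)) + window_count xs"

lemma window_sign_rev: "window_sign (rev w) = - window_sign w"
  by (simp add: window_sign_def)

lemma asym_window_uminus: "asym_window (map uminus w) \<longleftrightarrow> asym_window w"
proof -
  have "map uminus w = v \<longleftrightarrow> w = map uminus v" for v :: "int list"
    by (auto simp: o_def)
  then show ?thesis by (auto simp: asym_window_def)
qed

lemma window_sign_uminus: "window_sign (map uminus w) = window_sign w"
  by (simp add: window_sign_def rev_map asym_window_uminus)

lemma window_sign_short: "length w < 6 \<Longrightarrow> window_sign w = 0"
  by (auto simp: window_sign_def asym_window_def)

lemma abs_window_sign_le: "\<bar>window_sign w\<bar> \<le> 1"
  by (simp add: window_sign_def)

lemma window_count_uminus: "window_count (map uminus s) = window_count s"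
proof (induction s)
  case (Cons x s)
  have "window_sign (take 6 (map uminus (x # s))) = window_sign (take 6 (x # s))"
    by (simp only: take_map window_sign_uminus)
  with Cons show ?case by simp
qed simp

text \<open>This is the recursion from the right end, with the last window written as a reversed
  prefix of the reversed list; it is what \<open>window_count_rev\<close> needs.\<close>

lemma window_count_snoc:
  "window_count (s @ [x]) = window_count s + window_sign (rev (take 6 (x # rev s)))"
proof (induction s)
  case (Cons y s)
  \<comment> \<open>If \<open>s\<close> has at least five entries, the first window misses
    \<open>x\<close> and the last one misses \<open>y\<close>. Otherwise both extended windows are
    the whole list, and the other two are too short to count.\<close>
  have "window_sign (take 6 (y # s @ [x])) + window_sign (rev (take 6 (x # rev s))) =
      window_sign (take 6 (y # s)) + window_sign (rev (take 6 (x # rev s @ [y])))"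
  proof (cases "length s \<ge> 5")
    case True
    then show ?thesis by simp
  next
    case False
    then show ?thesis by (simp add: window_sign_short)
  qed
  with Cons show ?case by simp
qed (simp add: window_sign_short)

lemma window_count_rev: "window_count (rev s) = - window_count s"
proof (induction s)
  case (Cons x s)
  then show ?case
    using window_count_snoc[of "rev s" x] window_sign_rev[of "take 6 (x # s)"] by simp
qed simp

text \<open>The error comes from the windows straddling the junction, which start among the last
  five entries of \<open>u\<close>. The minimum lets the induction grow the bound only while
  \<open>u\<close> is short.\<close>

lemma window_count_append_aux:
  "\<bar>window_count (u @ v) - window_count u - window_count v\<bar> \<le> min 5 (int (length u))"
proof (induction u)
  case (Cons x u)
  show ?case
  proof (cases "length u \<ge> 5")
    case True
    then show ?thesis using Cons by simp
  next
    case False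
    then have "window_sign (take 6 (x # u)) = 0" by (simp add: window_sign_short)
    then show ?thesis
      using False Cons abs_window_sign_le[of "take 6 (x # u @ v)"] by simp
  qed
qed simp

lemma window_count_append:
  "\<bar>window_count (u @ v) - window_count u - window_count v\<bar> \<le> 5"
  using window_count_append_aux[of u v] by simp

text \<open>The palindrome \<open>p @ x\<close> has count 0, so \<open>p\<close> has almost the
  count of \<open>map uminus (rev x)\<close>. Three uses of almost additivity, each with error at
  most 5, give 15.\<close>

lemma window_count_cancel:
  assumes "rev (p @ x) = p @ x"
  shows "\<bar>window_count (p @ q) - window_count (map uminus (rev x) @ q)\<bar> \<le> 15"
proof -
  have "window_count (p @ x) = 0"
    using window_count_rev[of "p @ x"] assms by simp
  moreover have "window_count (map uminus (rev x)) = - window_count x"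
    by (simp add: window_count_uminus window_count_rev)
  ultimately show ?thesis
    using window_count_append[of p x] window_count_append[of p q]
      window_count_append[of "map uminus (rev x)" q]
    by linarith
qed

text \<open>The two asymmetric windows in succession. In its powers no reversed window occurs, and
  none of these windows straddles two of the pieces.\<close>

definition exponent_block :: "int list" where
  "exponent_block = [1,-1,-1,1,1,1,-1,1,1,-1,-1,-1]"

lemma window_count_block_Nil: "window_count exponent_block = 2"
  by (simp add: exponent_block_def window_sign_def asym_window_def)

text \<open>A window that starts in the block reaches at most five entries into \<open>s\<close>, so
  these five entries decide all straddling windows.\<close>

lemma window_count_block_append:
  assumes "take 5 s = [1,-1,-1,1,1]"
  shows "window_count (exponent_block @ s) = 2 + window_count s"
proof -
  \<comment> \<open>Unfolding the straddling windows leaves the prefixes of \<open>s\<close> of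
    lengths 1 to 5; the instances below evaluate the shorter ones.\<close>
  have "take k s = take k [1,-1,-1,1,1]" if "k \<le> 5" for k
    using that by (simp add: assms[symmetric] min_def)
  from this[of 1] this[of 2] this[of 3] this[of 4] assms show ?thesis
    by (simp add: exponent_block_def window_sign_def asym_window_def)
qed

lemma window_count_block_power:
  "window_count (concat (replicate (Suc n) exponent_block)) = 2 * int (Suc n)"
proof (induction n)
  case 0
  then show ?case by (simp add: window_count_block_Nil)
next
  case (Suc n)
  have "take 5 (concat (replicate (Suc n) exponent_block)) = [1,-1,-1,1,1]"
    by (simp add: exponent_block_def)
  from window_count_block_append[OF this] Suc show ?case by simp
qed

section \<open>The action on normal forms\<close>

text \<open>
  \<open>D e\<close> is the associated subgroup that can be moved to the left across \<open>t\<^sup>e\<close>, that is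
  \<open>t\<^sup>e d = \<psi> e d t\<^sup>e\<close> for \<open>d \<in> D e\<close>. In the notation of the theorem, \<open>D (-1) = A\<close>, \<open>D 1 = B\<close>,
  \<open>\<psi> (-1) = \<phi>\<close> and \<open>\<psi> 1 = \<phi>\<^sup>-\<^sup>1\<close>.
\<close>

locale hnn_data = group G for G :: "('a, 'b) monoid_scheme" (structure) +
  fixes D :: "int \<Rightarrow> 'a set" and \<psi> :: "int \<Rightarrow> 'a \<Rightarrow> 'a"
  assumes subgroup_D: "e \<in> {1, -1} \<Longrightarrow> subgroup (D e) G"
    and \<psi>_closed: "e \<in> {1, -1} \<Longrightarrow> d \<in> D e \<Longrightarrow> \<psi> e d \<in> D (- e)"
    and \<psi>_mult: "e \<in> {1, -1} \<Longrightarrow> d \<in> D e \<Longrightarrow> d' \<in> D e \<Longrightarrow> \<psi> e (d \<otimes> d') = \<psi> e d \<otimes> \<psi> e d'"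
    and \<psi>_inverse: "e \<in> {1, -1} \<Longrightarrow> d \<in> D e \<Longrightarrow> \<psi> (- e) (\<psi> e d) = d"
begin

lemma uminus_exponent: "e \<in> {1, -1} \<Longrightarrow> - e \<in> {1, -1 :: int}"
  by auto

lemma D_carrier: "e \<in> {1, -1} \<Longrightarrow> d \<in> D e \<Longrightarrow> d \<in> carrier G"
  using subgroup_D subgroup.subset by blast

lemma \<psi>_carrier: "e \<in> {1, -1} \<Longrightarrow> d \<in> D e \<Longrightarrow> \<psi> e d \<in> carrier G"
  using \<psi>_closed D_carrier uminus_exponent by blast

section \<open>Right cosets of the associated subgroups\<close>

lemma D_mult_left_iff:
  assumes "e \<in> {1, -1}" "d \<in> D e" "g \<in> carrier G"
  shows "d \<otimes> g \<in> D e \<longleftrightarrow> g \<in> D e"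
proof -
  interpret D: subgroup "D e" G using assms(1) by (rule subgroup_D)
  have "g = inv d \<otimes> (d \<otimes> g)" using assms by (simp add: m_assoc[symmetric])
  then show ?thesis using assms by (metis D.m_closed D.m_inv_closed)
qed

lemma D_mult_right_iff:
  assumes "e \<in> {1, -1}" "d \<in> D e" "g \<in> carrier G"
  shows "g \<otimes> d \<in> D e \<longleftrightarrow> g \<in> D e"
proof -
  interpret D: subgroup "D e" G using assms(1) by (rule subgroup_D)
  have "g = (g \<otimes> d) \<otimes> inv d" using assms by (simp add: m_assoc)
  then show ?thesis using assms by (metis D.m_closed D.m_inv_closed)
qed

text \<open>The condition on \<open>r\<close> says that \<open>r\<close> and \<open>g\<close> have
  the same right coset of \<open>D e\<close>. Choosing \<one> for the subgroup itself lets normal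
  forms recognize where two stable letters could cancel.\<close>

definition coset_rep :: "int \<Rightarrow> 'a \<Rightarrow> 'a" where
  "coset_rep e g = (if g \<in> D e then \<one> else SOME r. r \<in> carrier G \<and> r \<otimes> inv g \<in> D e)"

lemma coset_rep:
  assumes "e \<in> {1, -1}" "g \<in> carrier G"
  shows coset_rep_carrier: "coset_rep e g \<in> carrier G"
    and coset_rep_quotient: "g \<otimes> inv (coset_rep e g) \<in> D e"
proof -
  interpret D: subgroup "D e" G using assms(1) by (rule subgroup_D)
  have "\<exists>r. r \<in> carrier G \<and> r \<otimes> inv g \<in> D e"
    using assms by (intro exI[of _ g]) simp
  then have "coset_rep e g \<in> carrier G \<and> coset_rep e g \<otimes> inv g \<in> D e"
    if "g \<notin> D e" using that unfolding coset_rep_def by (simp only: if_False) (rule someI_ex)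
  moreover have "g \<otimes> inv r = inv (r \<otimes> inv g)" if "r \<in> carrier G" for r
    using that assms by (simp add: inv_mult_group)
  ultimately show "coset_rep e g \<in> carrier G" "g \<otimes> inv (coset_rep e g) \<in> D e"
    by (cases "g \<in> D e"; simp add: coset_rep_def)+
qed

lemma coset_rep_mult:
  assumes "e \<in> {1, -1}" "d \<in> D e" "g \<in> carrier G"
  shows "coset_rep e (d \<otimes> g) = coset_rep e g"
proof -
  interpret D: subgroup "D e" G using assms(1) by (rule subgroup_D)
  have "r \<otimes> inv (d \<otimes> g) \<in> D e \<longleftrightarrow> r \<otimes> inv g \<in> D e" if "r \<in> carrier G" for r
  proof -
    have "r \<otimes> inv (d \<otimes> g) = r \<otimes> inv g \<otimes> inv d"
      using that assms by (simp add: inv_mult_group m_assoc)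
    then show ?thesis using D_mult_right_iff[of e "inv d" "r \<otimes> inv g"] that assms by simp
  qed
  \<comment> \<open>The two predicates are equal as functions, hence \<open>SOME\<close> picks the
    same element for both.\<close>
  then have "(\<lambda>r. r \<in> carrier G \<and> r \<otimes> inv (d \<otimes> g) \<in> D e) =
      (\<lambda>r. r \<in> carrier G \<and> r \<otimes> inv g \<in> D e)" by blast
  then show ?thesis using D_mult_left_iff[OF assms] by (simp add: coset_rep_def)
qed

lemma coset_rep_decomp:
  assumes "e \<in> {1, -1}" "g \<in> carrier G"
  shows "g \<otimes> inv (coset_rep e g) \<otimes> coset_rep e g = g"
  using assms coset_rep_carrier by (simp add: m_assoc)

lemma coset_rep_idem:
  assumes "e \<in> {1, -1}" "g \<in> carrier G"
  shows "coset_rep e (coset_rep e g) = coset_rep e g"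
  using coset_rep_mult[OF assms(1) coset_rep_quotient[OF assms] coset_rep_carrier[OF assms]]
  by (simp add: coset_rep_decomp[OF assms])

lemma coset_rep_in_D: "g \<in> D e \<Longrightarrow> coset_rep e g = \<one>"
  by (simp add: coset_rep_def)

lemma coset_rep_eq_one:
  assumes "e \<in> {1, -1}" "g \<in> carrier G" "coset_rep e g = \<one>"
  shows "g \<in> D e"
  using coset_rep_quotient[OF assms(1,2)] assms by simp

text \<open>
  The normal form \<open>(g, [(e\<^sub>1, r\<^sub>1), \<dots>, (e\<^sub>n, r\<^sub>n)])\<close> stands for the element
  \<open>g t\<^bsup>e\<^sub>1\<^esup> r\<^sub>1 \<dots> t\<^bsup>e\<^sub>n\<^esup> r\<^sub>n\<close>.
\<close>

fun normal_tail :: "(int \<times> 'a) list \<Rightarrow> bool" where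
  "normal_tail [] \<longleftrightarrow> True"
| "normal_tail ((e, r) # l) \<longleftrightarrow> e \<in> {1, -1} \<and> r \<in> carrier G \<and> coset_rep e r = r \<and>
    (r = \<one> \<longrightarrow> l = [] \<or> fst (hd l) \<noteq> - e) \<and> normal_tail l"

definition normal_form :: "'a \<times> (int \<times> 'a) list \<Rightarrow> bool" where
  "normal_form s \<longleftrightarrow> fst s \<in> carrier G \<and> normal_tail (snd s)"

definition base_act :: "'a \<Rightarrow> 'a \<times> (int \<times> 'a) list \<Rightarrow> 'a \<times> (int \<times> 'a) list" where
  "base_act h s = (h \<otimes> fst s, snd s)"

text \<open>Left multiplication by \<open>t^e\<close>. If \<open>g\<close> lies in
  \<open>D e\<close> and \<open>t^(-e)\<close> follows, then \<open>t^e g t^(-e)\<close> collapses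
  to \<open>\<psi> e g\<close>. Otherwise \<open>g\<close> is split into its part in
  \<open>D e\<close>, which moves across \<open>t^e\<close>, and its representative.\<close>

definition stable_act :: "int \<Rightarrow> 'a \<times> (int \<times> 'a) list \<Rightarrow> 'a \<times> (int \<times> 'a) list" where
  "stable_act e s = (let (g, l) = s in
    if g \<in> D e \<and> l \<noteq> [] \<and> fst (hd l) = - e
    then (\<psi> e g \<otimes> snd (hd l), tl l)
    else (\<psi> e (g \<otimes> inv (coset_rep e g)), (e, coset_rep e g) # l))"

primrec letter_act :: "'a hnn_letter \<Rightarrow> 'a \<times> (int \<times> 'a) list \<Rightarrow> 'a \<times> (int \<times> 'a) list" where
  "letter_act (Base g) = base_act g"
| "letter_act (Stable e) = stable_act e"

definition word_act :: "'a hnn_letter list \<Rightarrow> 'a \<times> (int \<times> 'a) list \<Rightarrow> 'a \<times> (int \<times> 'a) list" where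
  "word_act w s = foldr letter_act w s"

definition exponents :: "'a \<times> (int \<times> 'a) list \<Rightarrow> int list" where
  "exponents s = map fst (snd s)"

lemma word_act_simps [simp]:
  "word_act [] s = s"
  "word_act (x # w) s = letter_act x (word_act w s)"
  "word_act (u @ v) s = word_act u (word_act v s)"
  by (simp_all add: word_act_def)

lemma stable_act_cancel:
  "g \<in> D e \<Longrightarrow> stable_act e (g, (- e, r) # l) = (\<psi> e g \<otimes> r, l)"
  by (simp add: stable_act_def)

lemma stable_act_extend:
  "\<not> (g \<in> D e \<and> l \<noteq> [] \<and> fst (hd l) = - e) \<Longrightarrow>
    stable_act e (g, l) = (\<psi> e (g \<otimes> inv (coset_rep e g)), (e, coset_rep e g) # l)"
  by (auto simp: stable_act_def)

lemma stable_act_cases: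
  obtains (cancel) r l' where "g \<in> D e" "l = (- e, r) # l'" "stable_act e (g, l) = (\<psi> e g \<otimes> r, l')"
  | (extend) "\<not> (g \<in> D e \<and> l \<noteq> [] \<and> fst (hd l) = - e)"
    "stable_act e (g, l) = (\<psi> e (g \<otimes> inv (coset_rep e g)), (e, coset_rep e g) # l)"
proof (cases "g \<in> D e \<and> l \<noteq> [] \<and> fst (hd l) = - e")
  case True
  then obtain r l' where "l = (- e, r) # l'" by (cases l) auto
  with True that(1) show ?thesis by (simp add: stable_act_cancel)
next
  case False
  with that(2) show ?thesis by (simp add: stable_act_extend)
qed

section \<open>Compatibility of the action with the defining relations\<close>

lemma normal_form_base_act:
  "h \<in> carrier G \<Longrightarrow> normal_form s \<Longrightarrow> normal_form (base_act h s)"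
  by (simp add: normal_form_def base_act_def)

lemma normal_form_stable_act:
  assumes e: "e \<in> {1, -1}" and s: "normal_form s"
  shows "normal_form (stable_act e s)"
proof -
  obtain g l where gl: "s = (g, l)" by fastforce
  have g: "g \<in> carrier G" and l: "normal_tail l" using s by (auto simp: normal_form_def gl)
  show ?thesis unfolding gl
  proof (cases rule: stable_act_cases[of g e l])
    case (cancel r l')
    then show "normal_form (stable_act e (g, l))"
      using l \<psi>_carrier[OF e] by (simp add: normal_form_def)
  next
    case extend
    then show "normal_form (stable_act e (g, l))"
      using l g e coset_rep_carrier[OF e g] coset_rep_idem[OF e g] coset_rep_eq_one[OF e g]
        \<psi>_carrier[OF e coset_rep_quotient[OF e g]]
      by (auto simp: normal_form_def)
  qed
qed

text \<open>Cancelling and extending undo each other. After a cancellation the normality of the tail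
  forces the inverse letter to extend; after an extension the leading element lies in
  \<open>D (- e)\<close>, so the inverse letter cancels.\<close>

lemma stable_act_inverse:
  assumes e: "e \<in> {1, -1}" and s: "normal_form s"
  shows "stable_act (- e) (stable_act e s) = s"
proof -
  obtain g l where gl: "s = (g, l)" by fastforce
  have g: "g \<in> carrier G" and l: "normal_tail l" using s by (auto simp: normal_form_def gl)
  have e': "- e \<in> {1, -1}" using e by (rule uminus_exponent)
  show ?thesis unfolding gl
  proof (cases rule: stable_act_cases[of g e l])
    case (cancel r l')
    have r: "r \<in> carrier G" "coset_rep (- e) r = r" "r = \<one> \<longrightarrow> l' = [] \<or> fst (hd l') \<noteq> e"
      using l cancel(2) by auto
    have p: "\<psi> e g \<in> D (- e)" "\<psi> e g \<in> carrier G"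
      using \<psi>_closed \<psi>_carrier e cancel(1) by auto
    have "coset_rep (- e) (\<psi> e g \<otimes> r) = r"
      using coset_rep_mult[OF e' p(1) r(1)] r(2) by simp
    moreover have "\<psi> e g \<otimes> r \<in> D (- e) \<longleftrightarrow> r = \<one>"
      using D_mult_left_iff[OF e' p(1) r(1)] coset_rep_in_D[of r "- e"]
        coset_rep_eq_one[OF e' r(1)] r(2) by auto
    moreover have "\<psi> e g \<otimes> r \<otimes> inv r = \<psi> e g" using p r by (simp add: m_assoc)
    ultimately show "stable_act (- e) (stable_act e (g, l)) = (g, l)"
      using cancel r(3) \<psi>_inverse[OF e cancel(1)]
      by (subst cancel(3), subst stable_act_extend) auto
  next
    case extend
    note q = coset_rep_quotient[OF e g]
    have "stable_act (- e) (stable_act e (g, l)) =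
        (\<psi> (- e) (\<psi> e (g \<otimes> inv (coset_rep e g))) \<otimes> coset_rep e g, l)"
      using extend(2) stable_act_cancel[OF \<psi>_closed[OF e q], of "coset_rep e g" l] by simp
    then show "stable_act (- e) (stable_act e (g, l)) = (g, l)"
      by (simp only: \<psi>_inverse[OF e q] coset_rep_decomp[OF e g])
  qed
qed

text \<open>This is the relation \<open>t^e d = \<psi> e d t^e\<close> on normal forms: multiplying
  by \<open>d\<close> changes neither the coset representative nor the branch taken.\<close>

lemma stable_act_base_act:
  assumes e: "e \<in> {1, -1}" and d: "d \<in> D e" and s: "normal_form s"
  shows "stable_act e (base_act d s) = base_act (\<psi> e d) (stable_act e s)"
proof -
  obtain g l where gl: "s = (g, l)" by fastforce
  have g: "g \<in> carrier G" and l: "normal_tail l" using s by (auto simp: normal_form_def gl)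
  have dc: "d \<in> carrier G" and pd: "\<psi> e d \<in> carrier G"
    using D_carrier \<psi>_carrier e d by auto
  show ?thesis unfolding gl base_act_def fst_conv snd_conv
  proof (cases rule: stable_act_cases[of g e l])
    case (cancel r l')
    then have "r \<in> carrier G" using l by simp
    then show "stable_act e (d \<otimes> g, l) =
        (\<psi> e d \<otimes> fst (stable_act e (g, l)), snd (stable_act e (g, l)))"
      using cancel D_mult_left_iff[OF e d g] \<psi>_mult[OF e d cancel(1)] pd
        \<psi>_carrier[OF e cancel(1)]
      by (simp add: stable_act_cancel m_assoc)
  next
    case extend
    note q = coset_rep_quotient[OF e g]
    have "d \<otimes> g \<otimes> inv (coset_rep e g) = d \<otimes> (g \<otimes> inv (coset_rep e g))"
      using dc g coset_rep_carrier[OF e g] by (simp add: m_assoc)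
    then show "stable_act e (d \<otimes> g, l) =
        (\<psi> e d \<otimes> fst (stable_act e (g, l)), snd (stable_act e (g, l)))"
      using extend D_mult_left_iff[OF e d g] \<psi>_mult[OF e d q] coset_rep_mult[OF e d g]
      by (simp add: stable_act_extend)
  qed
qed

lemma normal_form_word_act:
  "w \<in> hnn_words G \<Longrightarrow> normal_form s \<Longrightarrow> normal_form (word_act w s)"
proof (induction w)
  case (Cons x w)
  then have "normal_form (word_act w s)" and "x \<in> Base ` carrier G \<union> Stable ` {1, -1}"
    by (auto simp: hnn_words_def)
  then show ?case
    using normal_form_base_act normal_form_stable_act by (elim UnE imageE) simp_all
qed simp

lemma word_act_hnn_eq:
  assumes "hnn_eq G (D (-1)) (\<psi> (-1)) u v" "normal_form s"
  shows "word_act u s = word_act v s"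
proof -
  \<comment> \<open>The claim ranges over all normal states and includes normality of the result,
    because in \<open>append\<close> the hypothesis for \<open>u\<close> is applied to the state
    reached by \<open>v\<close>.\<close>
  have "\<forall>s. normal_form s \<longrightarrow> word_act u s = word_act v s \<and> normal_form (word_act u s)"
    using assms(1)
  proof (induction rule: hnn_eq.induct)
    case (refl w)
    then show ?case by (simp add: normal_form_word_act)
  next
    case (sym v w)
    then show ?case by metis
  next
    case (trans u v w)
    then show ?case by metis
  next
    case (append u u' v v')
    then show ?case by (metis word_act_simps(3))
  next
    case (mult g h)
    then show ?case
      by (auto simp: normal_form_def base_act_def m_assoc)
  next
    case one
    then show ?case by (auto simp: normal_form_def base_act_def)
  next
    case (cancel e)
    then have "- e \<in> {1, -1}" by (rule uminus_exponent)
    then show ?case using stable_act_inverse[of "- e"] by simp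
  next
    case (conj a)
    have "stable_act (-1) (base_act a (stable_act 1 s)) = base_act (\<psi> (-1) a) s"
      if "normal_form s" for s
      using that conj stable_act_base_act[of "-1" a "stable_act 1 s"] normal_form_stable_act[of 1 s]
        stable_act_inverse[of 1 s] by simp
    moreover have "\<psi> (-1) a \<in> carrier G" using \<psi>_carrier[of "-1" a] conj by simp
    ultimately show ?case by (simp add: normal_form_base_act)
  qed
  with assms(2) show ?thesis by blast
qed

section \<open>Exponent sequences\<close>

lemma hnn_word_singleton: "hnn_word [g] [] = [Base g]"
  by (simp add: hnn_word_def)

lemma hnn_word_Cons:
  "hnn_word (g # h # gs) (e # es) = Base g # Stable e # hnn_word (h # gs) es"
  by (simp add: hnn_word_def)

abbreviation reduced :: "'a list \<Rightarrow> int list \<Rightarrow> bool" where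
  "reduced \<equiv> hnn_reduced G (D (-1)) (D 1)"

lemma hnn_word_in_words: "reduced gs es \<Longrightarrow> hnn_word gs es \<in> hnn_words G"
proof (induction es arbitrary: gs)
  case Nil
  then obtain g where "gs = [g]" "g \<in> carrier G"
    by (auto simp: hnn_reduced_def length_Suc_conv)
  then show ?case by (simp add: hnn_word_singleton hnn_words_def)
next
  case (Cons e es)
  then obtain g h gs' where gs: "gs = g # h # gs'"
    by (auto simp: hnn_reduced_def length_Suc_conv)
  have "reduced (h # gs') es" using Cons.prems by (fastforce simp: hnn_reduced_def gs)
  then have "hnn_word (h # gs') es \<in> hnn_words G" by (rule Cons.IH)
  moreover have "g \<in> carrier G" "e \<in> {1, -1}" using Cons.prems by (auto simp: hnn_reduced_def gs)
  ultimately show ?case by (auto simp: gs hnn_word_Cons hnn_words_def)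
qed

text \<open>
  The last conjunct drives the induction: it says that the leading base element of the result
  still lies in the coset of the first letter, so a further stable letter cancels against the
  result only if the extended word is not reduced.
\<close>

lemma exponents_word_act_aux:
  assumes "reduced gs es" "normal_form s"
  shows "\<exists>p x q. es = p @ x \<and> exponents s = map uminus (rev x) @ q \<and>
    exponents (word_act (hnn_word gs es) s) = p @ q \<and>
    (p \<noteq> [] \<longrightarrow> (\<exists>d \<in> D (- hd p). fst (word_act (hnn_word gs es) s) = hd gs \<otimes> d))"
  using assms(1)
proof (induction es arbitrary: gs)
  case Nil
  then obtain g where "gs = [g]" by (auto simp: hnn_reduced_def length_Suc_conv)
  then show ?case by (simp add: hnn_word_singleton base_act_def exponents_def)
next
  case (Cons e es)
  then obtain g h gs' where gs: "gs = g # h # gs'"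
    by (auto simp: hnn_reduced_def length_Suc_conv)
  have red: "reduced (h # gs') es" using Cons.prems by (fastforce simp: hnn_reduced_def gs)
  have ge: "g \<in> carrier G" "e \<in> {1, -1}" "h \<in> carrier G"
    using Cons.prems by (auto simp: hnn_reduced_def gs)
  \<comment> \<open>Both excluded patterns of a reduced word take this one form, since
    \<open>D (-1)\<close> and \<open>D 1\<close> are the two associated subgroups.\<close>
  have first: "\<not> (h \<in> D e \<and> es \<noteq> [] \<and> hd es = - e)"
  proof
    assume *: "h \<in> D e \<and> es \<noteq> [] \<and> hd es = - e"
    then have "es ! 0 = - e" by (metis hd_conv_nth)
    then show False using * Cons.prems ge(2) by (auto simp: hnn_reduced_def gs)
  qed
  define s' where "s' = word_act (hnn_word (h # gs') es) s"
  obtain k l where kl: "s' = (k, l)" by fastforce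
  have "normal_form s'"
    using normal_form_word_act[OF hnn_word_in_words[OF red] assms(2)] by (simp add: s'_def)
  then have k: "k \<in> carrier G" by (simp add: normal_form_def kl)
  obtain p x q where IH: "es = p @ x" "exponents s = map uminus (rev x) @ q" "exponents s' = p @ q"
    "p \<noteq> [] \<longrightarrow> (\<exists>d \<in> D (- hd p). k = h \<otimes> d)"
    using Cons.IH[OF red] unfolding s'_def[symmetric] kl fst_conv list.sel by blast
  have act: "word_act (hnn_word gs (e # es)) s = base_act g (stable_act e (k, l))"
    by (simp add: gs hnn_word_Cons s'_def[symmetric] kl)
  have l: "map fst l = p @ q" using IH(3) by (simp add: exponents_def kl)
  show ?case
  proof (cases rule: stable_act_cases[of k e l])
    case (cancel r l')
    have "p = []"
    proof (rule ccontr)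
      assume p: "p \<noteq> []"
      then have "hd p = - e" using l cancel(2) by (cases p) auto
      moreover from this obtain d where "d \<in> D e" "k = h \<otimes> d" using IH(4) p by auto
      ultimately show False
        using first D_mult_right_iff[OF ge(2) _ ge(3)] cancel(1) p IH(1) by auto
    qed
    \<comment> \<open>With \<open>p\<close> empty, the letter cancelled by \<open>e\<close> is the
      head of \<open>q\<close>; it joins the cancelled part, which becomes all of
      \<open>e # es\<close>.\<close>
    then have "exponents s = map uminus (rev (e # es)) @ map fst l'"
      using IH(1,2) l cancel(2) by auto
    moreover have "exponents (word_act (hnn_word gs (e # es)) s) = [] @ map fst l'"
      using cancel(3) by (simp add: act exponents_def base_act_def)
    ultimately show ?thesis by blast
  next
    case extend
    let ?d = "\<psi> e (k \<otimes> inv (coset_rep e k))"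
    have "?d \<in> D (- hd (e # p))"
      using \<psi>_closed[OF ge(2) coset_rep_quotient[OF ge(2) k]] by simp
    moreover have "e # es = (e # p) @ x" using IH(1) by simp
    moreover have "exponents (word_act (hnn_word gs (e # es)) s) = (e # p) @ q"
      "fst (word_act (hnn_word gs (e # es)) s) = hd gs \<otimes> ?d"
      using l extend(2) unfolding act by (simp_all add: exponents_def base_act_def gs)
    ultimately show ?thesis using IH(2) by blast
  qed
qed

lemma exponents_word_act:
  assumes "reduced gs es" "normal_form s"
  obtains p x q where "es = p @ x" "exponents s = map uminus (rev x) @ q"
    "exponents (word_act (hnn_word gs es) s) = p @ q"
  using exponents_word_act_aux[OF assms] by blast

definition initial :: "'a \<times> (int \<times> 'a) list" where
  "initial = (\<one>, [])"

lemma normal_form_initial: "normal_form initial"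
  by (simp add: normal_form_def initial_def)

text \<open>The initial state has no exponents, so nothing can cancel against it. With
  \<open>word_act_hnn_eq\<close>, the exponent sequence becomes an invariant of the element
  represented.\<close>

lemma exponents_reduced:
  assumes "reduced gs es"
  shows "exponents (word_act (hnn_word gs es) initial) = es"
proof -
  have "exponents initial = []" by (simp add: exponents_def initial_def)
  with exponents_word_act[OF assms normal_form_initial] show ?thesis by fastforce
qed

lemma ex_reduced:
  assumes "D 1 \<noteq> carrier G" "D (-1) \<noteq> carrier G" "set es \<subseteq> {1, -1}"
  shows "\<exists>gs. reduced gs es"
proof -
  have "\<exists>c. c \<in> carrier G \<and> c \<notin> D e" if "e \<in> {1, -1}" for e
    using that assms(1,2) D_carrier[of e] by blast
  then obtain c where c: "\<And>e. e \<in> {1, -1} \<Longrightarrow> c e \<in> carrier G \<and> c e \<notin> D e" by metis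
  \<comment> \<open>Each \<open>t^e\<close> is followed by an element outside \<open>D e\<close>,
    which rules out every forbidden subsequence.\<close>
  have "reduced (\<one> # map c es) es"
    unfolding hnn_reduced_def using assms(3) c by auto
  then show ?thesis ..
qed

section \<open>Palindromes\<close>

definition palindrome_word :: "'a hnn_letter list \<Rightarrow> bool" where
  "palindrome_word w \<longleftrightarrow>
    (\<exists>gs es. w = hnn_word gs es \<and> reduced gs es \<and> rev gs = gs \<and> rev es = es)"

lemma palindrome_word_in_words: "palindrome_word w \<Longrightarrow> w \<in> hnn_words G"
  by (auto simp: palindrome_word_def hnn_word_in_words)

text \<open>The palindromic exponent sequence splits into a surviving part \<open>p\<close> and a
  cancelled part \<open>x\<close>; the action replaces the prefix \<open>map uminus (rev x)\<close>
  of the old sequence by \<open>p\<close>.\<close>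

lemma window_count_palindrome_act:
  assumes "palindrome_word w" "normal_form s"
  shows "\<bar>window_count (exponents (word_act w s)) - window_count (exponents s)\<bar> \<le> 15"
proof -
  obtain gs es where w: "w = hnn_word gs es" "reduced gs es" "rev es = es"
    using assms(1) by (auto simp: palindrome_word_def)
  obtain p x q where "es = p @ x" "exponents s = map uminus (rev x) @ q"
    "exponents (word_act w s) = p @ q"
    using exponents_word_act[OF w(2) assms(2)] w(1) by blast
  then show ?thesis using w(3) window_count_cancel[of p x q] by simp
qed

lemma window_count_palindrome_product:
  assumes "\<forall>w \<in> set ws. palindrome_word w"
  shows "\<bar>window_count (exponents (word_act (concat ws) initial))\<bar> \<le> 15 * int (length ws)"
  using assms
proof (induction ws)
  case Nil
  then show ?case by (simp add: exponents_def initial_def)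
next
  case (Cons w ws)
  have "concat ws \<in> hnn_words G"
    using Cons.prems palindrome_word_in_words unfolding hnn_words_def in_lists_conv_set by auto
  then have "normal_form (word_act (concat ws) initial)"
    using normal_form_word_act normal_form_initial by blast
  then show ?case
    using Cons window_count_palindrome_act[of w "word_act (concat ws) initial"] by simp
qed

lemma \<psi>_image: "\<psi> (-1) ` D (-1) \<subseteq> carrier G"
  using \<psi>_carrier[of "-1"] by auto

text \<open>The action is defined on words, so a product of palindromic classes is lifted to one
  concatenation of palindromic words.\<close>

lemma foldr_palindromes:
  assumes "set ps \<subseteq> hnn_palindromes G (D (-1)) (D 1) (\<psi> (-1))"
  shows "\<exists>ws. length ws = length ps \<and> (\<forall>w \<in> set ws. palindrome_word w) \<and>
    concat ws \<in> hnn_words G \<and>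
    foldr (\<lambda>p q. p \<otimes>\<^bsub>hnn_extension G (D (-1)) (\<psi> (-1))\<^esub> q) ps
      \<one>\<^bsub>hnn_extension G (D (-1)) (\<psi> (-1))\<^esub> = hnn_class G (D (-1)) (\<psi> (-1)) (concat ws)"
  using assms
proof (induction ps)
  case Nil
  then show ?case by (simp add: hnn_words_def hnn_extension_def)
next
  case (Cons p ps)
  then obtain ws where ws: "length ws = length ps" "\<forall>w \<in> set ws. palindrome_word w"
    "concat ws \<in> hnn_words G"
    "foldr (\<lambda>p q. p \<otimes>\<^bsub>hnn_extension G (D (-1)) (\<psi> (-1))\<^esub> q) ps
      \<one>\<^bsub>hnn_extension G (D (-1)) (\<psi> (-1))\<^esub> = hnn_class G (D (-1)) (\<psi> (-1)) (concat ws)"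
    by auto
  obtain w where w: "palindrome_word w" "p = hnn_class G (D (-1)) (\<psi> (-1)) w"
    using Cons.prems by (auto simp: hnn_palindromes_def palindrome_word_def)
  have A: "subgroup (D (-1)) G" by (simp add: subgroup_D)
  show ?case
    using ws w palindrome_word_in_words[OF w(1)]
      hnn_mult_class[OF is_group A \<psi>_image, of w "concat ws"]
      hnn_words_append[OF is_group A \<psi>_image, of w "concat ws"]
    by (intro exI[of _ "w # ws"]) simp
qed

section \<open>From the window count to the palindromic width\<close>

lemma window_count_palindromic_length:
  assumes red: "reduced gs es"
  defines "x \<equiv> hnn_class G (D (-1)) (\<psi> (-1)) (hnn_word gs es)"
  shows "\<bar>window_count es\<bar> \<le> 15 * int (hnn_palindromic_length G (D (-1)) (D 1) (\<psi> (-1)) x)"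
proof -
  let ?H = "hnn_extension G (D (-1)) (\<psi> (-1))"
  have A: "subgroup (D (-1)) G" by (simp add: subgroup_D)
  have "x \<in> carrier ?H"
    using hnn_word_in_words[OF red] by (simp add: x_def hnn_extension_def)
  \<comment> \<open>Some factorization into palindromes exists, so the least length is attained by
    an actual list \<open>ps\<close>.\<close>
  from LeastI_ex[OF hnn_palindromic_length_exists[OF is_group A \<psi>_image this, of "D 1"]]
  obtain ps where ps: "length ps = hnn_palindromic_length G (D (-1)) (D 1) (\<psi> (-1)) x"
    "set ps \<subseteq> hnn_palindromes G (D (-1)) (D 1) (\<psi> (-1))"
    "x = foldr (\<lambda>p q. p \<otimes>\<^bsub>?H\<^esub> q) ps \<one>\<^bsub>?H\<^esub>"
    unfolding hnn_palindromic_length_def by blast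
  obtain ws where ws: "length ws = length ps" "\<forall>w \<in> set ws. palindrome_word w"
    "x = hnn_class G (D (-1)) (\<psi> (-1)) (concat ws)"
    using foldr_palindromes[OF ps(2)] ps(3) by auto
  have "hnn_eq G (D (-1)) (\<psi> (-1)) (hnn_word gs es) (concat ws)"
    using ws(3) hnn_class_eq_iff[OF is_group A \<psi>_image hnn_word_in_words[OF red]]
    by (simp add: x_def)
  then have "exponents (word_act (concat ws) initial) = es"
    using word_act_hnn_eq normal_form_initial exponents_reduced[OF red] by metis
  then show ?thesis using window_count_palindrome_product[OF ws(2)] ws(1) ps(1) by simp
qed

lemma hnn_palindromic_width_infinite:
  assumes "D 1 \<noteq> carrier G" "D (-1) \<noteq> carrier G"
  shows "hnn_palindromic_width G (D (-1)) (D 1) (\<psi> (-1)) = \<infinity>"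
proof (rule ccontr)
  assume "hnn_palindromic_width G (D (-1)) (D 1) (\<psi> (-1)) \<noteq> \<infinity>"
  then obtain N where N: "hnn_palindromic_width G (D (-1)) (D 1) (\<psi> (-1)) = enat N" by auto
  \<comment> \<open>A width of \<open>N\<close> would bound the count by \<open>15 * N\<close>,
    whereas this power of the block has count \<open>2 * (15 * N + 1)\<close>.\<close>
  define es where "es = concat (replicate (Suc (15 * N)) exponent_block)"
  have "set es \<subseteq> {1, -1}" by (auto simp: es_def exponent_block_def)
  then obtain gs where red: "reduced gs es" using ex_reduced assms by blast
  let ?x = "hnn_class G (D (-1)) (\<psi> (-1)) (hnn_word gs es)"
  have "?x \<in> carrier (hnn_extension G (D (-1)) (\<psi> (-1)))"
    using hnn_word_in_words[OF red] by (simp add: hnn_extension_def)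
  then have "enat (hnn_palindromic_length G (D (-1)) (D 1) (\<psi> (-1)) ?x) \<le> enat N"
    unfolding N[symmetric] hnn_palindromic_width_def by (rule SUP_upper)
  moreover have "window_count es = 2 * int (Suc (15 * N))"
    unfolding es_def by (rule window_count_block_power)
  ultimately show False using window_count_palindromic_length[OF red] by simp
qed

end

theorem theorem1p1:
  fixes G :: "('a, 'b) monoid_scheme" and A B :: "'a set" and \<phi> :: "'a \<Rightarrow> 'a"
  assumes "group G"
    and "subgroup A G" and "A \<noteq> carrier G"
    and "subgroup B G" and "B \<noteq> carrier G"
    and "\<phi> \<in> iso (G\<lparr>carrier := A\<rparr>) (G\<lparr>carrier := B\<rparr>)"
  shows "hnn_palindromic_width G A B \<phi> = \<infinity>"
proof -
  have bij: "bij_betw \<phi> A B"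
    and hom: "\<And>a b. a \<in> A \<Longrightarrow> b \<in> A \<Longrightarrow> \<phi> (a \<otimes>\<^bsub>G\<^esub> b) = \<phi> a \<otimes>\<^bsub>G\<^esub> \<phi> b"
    using assms(6) by (auto simp: iso_def hom_def)
  have inv_closed: "inv_into A \<phi> b \<in> A" and inv_right: "\<phi> (inv_into A \<phi> b) = b"
    if "b \<in> B" for b
    using that bij by (metis bij_betw_imp_surj_on inv_into_into,
        metis bij_betw_imp_surj_on f_inv_into_f)
  have inv_left: "inv_into A \<phi> (\<phi> a) = a" if "a \<in> A" for a
    using that bij by (meson bij_betw_imp_inj_on inv_into_f_f)
  have inv_mult: "inv_into A \<phi> (b \<otimes>\<^bsub>G\<^esub> b') = inv_into A \<phi> b \<otimes>\<^bsub>G\<^esub> inv_into A \<phi> b'"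
    if "b \<in> B" "b' \<in> B" for b b'
    using that hom inv_left inv_right inv_closed subgroup.m_closed[OF assms(2)] by metis
  \<comment> \<open>The defining relation reads \<open>t^(-1) a = \<phi> a t^(-1)\<close> for
    \<open>a\<close> in \<open>A\<close>, and equivalently
    \<open>t b = inv_into A \<phi> b t\<close> for \<open>b\<close> in \<open>B\<close>; these are
    the two cases of the indexed data.\<close>
  define D where "D = (\<lambda>e::int. if e = 1 then B else A)"
  define \<psi> where "\<psi> = (\<lambda>e::int. if e = 1 then inv_into A \<phi> else \<phi>)"
  have "\<phi> a \<in> B" if "a \<in> A" for a using that bij by (auto simp: bij_betw_def)
  then have "hnn_data G D \<psi>"
    using assms(1,2,4) hom inv_closed inv_right inv_left inv_mult
    by (auto simp: hnn_data_def hnn_data_axioms_def D_def \<psi>_def)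
  from hnn_data.hnn_palindromic_width_infinite[OF this] show ?thesis
    using assms(3,5) by (simp add: D_def \<psi>_def)
qed

end
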